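(* Let $\mathcal{H}$ be a separable complex Hilbert space and let $A$ be a bounded anti-linear operator on $\mathcal{H}$. Then there exists a unique anti-linear partial isometry $J$ on $\mathcal{H}$ such that $A=J|A|$ and $\ker J=\ker A$.
   Context: For a bounded anti-linear operator $X$ on $\mathcal{H}$, the anti-linear adjoint $X^{\#}$ is the unique bounded anti-linear operator with $\langle Xx,y\rangle=\overline{\langle x,X^{\#}y\rangle}$ for all $x,y\in\mathcal{H}$; then $X^{\#}X$ is a positive bounded linear operator and $|X|:=(X^{\#}X)^{1/2}$. An anti-linear partial isometry is a bounded anti-linear operator $J$ with $\|Jx\|=\|x\|$ for all $x\in(\ker J)^\perp$. *)

theory Defs
  imports "HOL-Analysis.Analysis"
begin

class complex_vector = real_vector +
  fixes scaleC :: "complex \<Rightarrow> 'a \<Rightarrow> 'a"  (infixr \<open>*\<^sub>C\<close> 75)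
  assumes scaleC_add_right: "c *\<^sub>C (x + y) = c *\<^sub>C x + c *\<^sub>C y"
    and scaleC_add_left: "(c + d) *\<^sub>C x = c *\<^sub>C x + d *\<^sub>C x"
    and scaleC_scaleC: "c *\<^sub>C d *\<^sub>C x = (c * d) *\<^sub>C x"
    and scaleC_one: "1 *\<^sub>C x = x"
    and scaleR_scaleC: "r *\<^sub>R x = complex_of_real r *\<^sub>C x"

(* The complex inner product is linear in its first argument. Its real part is the
   inner product of the underlying real inner product space; positive definiteness,
   the norm and the topology are inherited from there (see cinner_self below). *)
class complex_inner = complex_vector + real_inner +
  fixes cinner :: "'a \<Rightarrow> 'a \<Rightarrow> complex"
  assumes cinner_commute: "cinner x y = cnj (cinner y x)"
    and cinner_add_left: "cinner (x + y) z = cinner x z + cinner y z"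
    and cinner_scaleC_left: "cinner (c *\<^sub>C x) y = c * cinner x y"
    and Re_cinner: "Re (cinner x y) = inner x y"

lemma cinner_self:
  fixes x :: "'a::complex_inner"
  shows "cinner x x = complex_of_real ((norm x)\<^sup>2)"
proof -
  have "Im (cinner x x) = 0"
    using arg_cong[OF cinner_commute[of x x], of Im] by simp
  then show ?thesis
    by (simp add: complex_eq_iff Re_cinner power2_norm_eq_inner)
qed

class complex_hilbert = complex_inner + complete_space

definition corthogonal_comp :: "'a::complex_inner set \<Rightarrow> 'a set" where
  "corthogonal_comp S = {x. \<forall>y\<in>S. cinner x y = 0}"

definition op_kernel :: "('a::zero \<Rightarrow> 'b::zero) \<Rightarrow> 'a set" where
  "op_kernel f = {x. f x = 0}"

(* bounded_linear refers to the underlying real normed spaces *)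
definition bounded_clinear :: "('a::complex_inner \<Rightarrow> 'b::complex_inner) \<Rightarrow> bool" where
  "bounded_clinear T \<longleftrightarrow> bounded_linear T \<and> (\<forall>c x. T (c *\<^sub>C x) = c *\<^sub>C T x)"

definition bounded_antilinear :: "('a::complex_inner \<Rightarrow> 'b::complex_inner) \<Rightarrow> bool" where
  "bounded_antilinear X \<longleftrightarrow> bounded_linear X \<and> (\<forall>c x. X (c *\<^sub>C x) = cnj c *\<^sub>C X x)"

definition antilinear_adjoint :: "('a::complex_hilbert \<Rightarrow> 'a) \<Rightarrow> 'a \<Rightarrow> 'a" where
  "antilinear_adjoint X =
     (THE Y. bounded_antilinear Y \<and> (\<forall>x y. cinner (X x) y = cnj (cinner x (Y y))))"

definition positive_op :: "('a::complex_hilbert \<Rightarrow> 'a) \<Rightarrow> bool" where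
  "positive_op T \<longleftrightarrow> bounded_clinear T \<and> (\<forall>x. cinner (T x) x \<in> \<real>\<^sub>\<ge>\<^sub>0)"

(* well defined for positive T, which have exactly one positive square root *)
definition sqrt_op :: "('a::complex_hilbert \<Rightarrow> 'a) \<Rightarrow> 'a \<Rightarrow> 'a" where
  "sqrt_op T = (THE S. positive_op S \<and> S \<circ> S = T)"

definition antilinear_abs :: "('a::complex_hilbert \<Rightarrow> 'a) \<Rightarrow> 'a \<Rightarrow> 'a" where
  "antilinear_abs X = sqrt_op (antilinear_adjoint X \<circ> X)"

definition antilinear_partial_isometry :: "('a::complex_hilbert \<Rightarrow> 'a) \<Rightarrow> bool" where
  "antilinear_partial_isometry J \<longleftrightarrow>
     bounded_antilinear J \<and> (\<forall>x\<in>corthogonal_comp (op_kernel J). norm (J x) = norm x)"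

end

theory Submission
  imports Defs
begin

text \<open>
  The modulus \<open>S = \<bar>A\<bar>\<close> satisfies \<open>\<parallel>S x\<parallel> = \<parallel>A x\<parallel>\<close> for every \<open>x\<close>, because both squares equal the value of the
  quadratic form of \<open>A\<^sup># A = S\<^sup>2\<close> at \<open>x\<close>. Hence \<open>S x \<mapsto> A x\<close> is a well-defined isometry on the range of
  \<open>S\<close>, and \<open>J\<close> must be its continuous extension to the closure \<open>M\<close> of that range. Since \<open>S\<close> is
  self-adjoint, the orthogonal complement of \<open>M\<close> is the kernel of \<open>S\<close>, which is the kernel of \<open>A\<close>,
  and there \<open>J\<close> must vanish. As \<open>M\<close> and its complement span the space, \<open>J\<close> is unique; and the map
  so described has kernel exactly the complement of \<open>M\<close>, so it is a partial isometry.

  The extension is not built by taking limits of \<open>A x\<^sub>n\<close>, which would require proving linearity by hand.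
  Instead, for each \<open>z\<close> the functional \<open>x \<mapsto> \<langle>A x, z\<rangle>\<close> is dominated by \<open>\<parallel>z\<parallel> \<parallel>S x\<parallel>\<close>, so it has the form
  \<open>x \<mapsto> \<langle>K z, S x\<rangle>\<close> for a unique \<open>K z\<close> in \<open>M\<close>; uniqueness makes \<open>K\<close> anti-linear, and \<open>J\<close> is the adjoint of
  \<open>K\<close>. The representation result behind this, \<open>dominated_functional_representation\<close>, is a form of the
  Riesz theorem relative to a linear map, and it also yields adjoints and orthogonal projections.

  The square root of a positive operator comes from the iteration in \<open>quadratic_fixed_point\<close>, whose limit
  commutes with everything that commutes with the operator; this commutation is what forces uniqueness of
  the root. Everything metric is done for the real inner product, the real part of the complex one.
  Complex linearity and anti-linearity are recovered afterwards: operators determined uniquely by real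
  inner products inherit their behaviour under complex scalars from the data that determine them.
\<close>

section \<open>Functionals dominated by a linear map, projections and adjoints\<close>

text \<open>Near \<open>t = 0\<close> the linear term dominates. This is the first-order condition at a minimum of a quadratic
  functional, in a form free of derivatives.\<close>

lemma nonneg_quadratic_imp_linear_coeff_zero:
  fixes a b :: real
  assumes "\<And>t. 0 \<le> 2 * t * a + t\<^sup>2 * b"
  shows "a = 0"
proof (rule ccontr)
  assume a: "a \<noteq> 0"
  define s where "s = \<bar>b\<bar> + 1"
  have s: "s > 0" "b < 2 * s" by (auto simp: s_def)
  \<comment> \<open>The vertex would be at \<open>- a / b\<close>; the choice of \<open>s\<close> also covers \<open>b \<le> 0\<close>.\<close>
  have "0 \<le> 2 * (- a / s) * a + (- a / s)\<^sup>2 * b"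
    by (rule assms)
  also have "\<dots> = (a / s)\<^sup>2 * (b - 2 * s)"
    using s by (simp add: field_simps power2_eq_square)
  also have "\<dots> < 0"
    using a s by (intro mult_pos_neg) auto
  finally show False by simp
qed

text \<open>Minimise \<open>F v = \<parallel>S v\<parallel>\<^sup>2 - 2 \<phi> v\<close>, which the domination bounds from below. By the parallelogram law the
  images under \<open>S\<close> of a minimising sequence are Cauchy. The first-order condition at their limit \<open>w\<close> is
  the desired identity. Only the images converge, and only in the ambient space, so \<open>w\<close> lies in the
  closure of the range and may have no preimage. With \<open>S = id\<close> this is the Riesz representation
  theorem.\<close>

lemma dominated_functional_representation:
  fixes S :: "'v::real_vector \<Rightarrow> 'a::{real_inner,complete_space}" and \<phi> :: "'v \<Rightarrow> real"
  assumes S: "linear S" and \<phi>: "linear \<phi>" and dom: "\<And>v. \<bar>\<phi> v\<bar> \<le> C * norm (S v)"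
  obtains w where "w \<in> closure (range S)" "\<And>v. \<phi> v = inner w (S v)"
proof -
  define F where "F v = (norm (S v))\<^sup>2 - 2 * \<phi> v" for v
  have lower: "- C\<^sup>2 \<le> F v" for v
  proof -
    have "0 \<le> (norm (S v) - C)\<^sup>2" by simp
    also have "\<dots> = (norm (S v))\<^sup>2 - 2 * (C * norm (S v)) + C\<^sup>2"
      by (simp add: power2_diff algebra_simps)
    also have "\<dots> \<le> F v + C\<^sup>2"
      using dom[of v] by (simp add: F_def)
    finally show ?thesis by simp
  qed
  define m where "m = Inf (range F)"
  have bdd: "bdd_below (range F)"
    using lower by (intro bdd_belowI2)
  have m_le: "m \<le> F v" for v
    unfolding m_def using bdd by (intro cInf_lower) auto
  have "\<exists>v. F v < m + inverse (real (Suc n))" for n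
  proof -
    have "m < m + inverse (real (Suc n))" by simp
    then show ?thesis
      unfolding m_def by (subst (asm) cInf_less_iff[OF _ bdd]) auto
  qed
  then obtain X where X: "\<And>n. F (X n) < m + inverse (real (Suc n))" by metis
  have F_lim: "(\<lambda>n. F (X n)) \<longlonglongrightarrow> m"
  proof (rule tendsto_sandwich[OF _ _ tendsto_const])
    show "(\<lambda>n. m + inverse (real (Suc n))) \<longlonglongrightarrow> m"
      using tendsto_add[OF tendsto_const LIMSEQ_inverse_real_of_nat, of m] by simp
  qed (use m_le X in \<open>auto intro!: always_eventually less_imp_le\<close>)
  have parallelogram: "(norm (S u - S v))\<^sup>2 \<le> 2 * (F u - m) + 2 * (F v - m)" for u v
  proof -
    have "(norm (S u - S v))\<^sup>2 = 2 * F u + 2 * F v - 4 * F ((1/2) *\<^sub>R (u + v))"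
      by (simp add: F_def linear_add[OF S] linear_scale[OF S] linear_add[OF \<phi>] linear_scale[OF \<phi>]
          power2_norm_eq_inner inner_simps inner_commute field_simps)
    then show ?thesis using m_le[of "(1/2) *\<^sub>R (u + v)"] by simp
  qed
  have "Cauchy (\<lambda>n. S (X n))"
  proof (rule metric_CauchyI)
    fix e :: real assume e: "e > 0"
    obtain N where N: "\<And>n. n \<ge> N \<Longrightarrow> inverse (real (Suc n)) < e\<^sup>2 / 4"
      using order_tendstoD(2)[OF LIMSEQ_inverse_real_of_nat, of "e\<^sup>2 / 4"] e
      unfolding eventually_sequentially by auto
    have "dist (S (X i)) (S (X j)) < e" if "i \<ge> N" "j \<ge> N" for i j
    proof -
      have "(norm (S (X i) - S (X j)))\<^sup>2 < e\<^sup>2"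
        using parallelogram[of "X i" "X j"] X[of i] X[of j] N[OF that(1)] N[OF that(2)] by simp
      then show ?thesis
        using e by (simp add: dist_norm power_less_imp_less_base)
    qed
    then show "\<exists>M. \<forall>i\<ge>M. \<forall>j\<ge>M. dist (S (X i)) (S (X j)) < e" by blast
  qed
  then obtain w where w: "(\<lambda>n. S (X n)) \<longlonglongrightarrow> w"
    using Cauchy_convergent convergent_def by blast
  have repr: "\<phi> v = inner w (S v)" for v
  proof -
    have "0 \<le> 2 * t * (inner w (S v) - \<phi> v) + t\<^sup>2 * (norm (S v))\<^sup>2" for t
    proof -
      have "m \<le> F (X n) + 2 * t * (inner (S (X n)) (S v) - \<phi> v) + t\<^sup>2 * (norm (S v))\<^sup>2" for n
      proof -
        have "F (X n + t *\<^sub>R v) = F (X n) + 2 * t * (inner (S (X n)) (S v) - \<phi> v) + t\<^sup>2 * (norm (S v))\<^sup>2"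
          unfolding F_def power2_norm_eq_inner
          by (simp add: linear_add[OF S] linear_scale[OF S] linear_add[OF \<phi>] linear_scale[OF \<phi>]
              inner_simps inner_commute algebra_simps power2_eq_square)
        then show ?thesis using m_le[of "X n + t *\<^sub>R v"] by simp
      qed
      moreover have "(\<lambda>n. F (X n) + 2 * t * (inner (S (X n)) (S v) - \<phi> v) + t\<^sup>2 * (norm (S v))\<^sup>2)
          \<longlonglongrightarrow> m + 2 * t * (inner w (S v) - \<phi> v) + t\<^sup>2 * (norm (S v))\<^sup>2"
        by (intro tendsto_intros F_lim w)
      ultimately have "m \<le> m + 2 * t * (inner w (S v) - \<phi> v) + t\<^sup>2 * (norm (S v))\<^sup>2"
        by (intro LIMSEQ_le_const) auto
      then show ?thesis by simp
    qed
    then have "inner w (S v) - \<phi> v = 0"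
      by (rule nonneg_quadratic_imp_linear_coeff_zero)
    then show ?thesis by simp
  qed
  have "w \<in> closure (range S)"
    unfolding closure_sequential using w by (intro exI[of _ "\<lambda>n. S (X n)"]) simp
  then show thesis using repr by (rule that)
qed

lemma subspace_closure:
  fixes V :: "'a::real_normed_vector set"
  assumes "subspace V"
  shows "subspace (closure V)"
proof (rule subspaceI)
  show "0 \<in> closure V"
    using closure_subset subspace_0[OF assms] by blast
next
  fix x y assume "x \<in> closure V" "y \<in> closure V"
  then obtain f g where f: "\<And>n. f n \<in> V" "f \<longlonglongrightarrow> x" and g: "\<And>n. g n \<in> V" "g \<longlonglongrightarrow> y"
    unfolding closure_sequential by auto
  have "(\<lambda>n. f n + g n) \<longlonglongrightarrow> x + y"
    by (intro tendsto_add f g)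
  then show "x + y \<in> closure V"
    unfolding closure_sequential using f(1) g(1) subspace_add[OF assms]
    by (intro exI[of _ "\<lambda>n. f n + g n"]) auto
next
  fix c :: real and x assume "x \<in> closure V"
  then obtain f where f: "\<And>n. f n \<in> V" "f \<longlonglongrightarrow> x"
    unfolding closure_sequential by auto
  have "(\<lambda>n. c *\<^sub>R f n) \<longlonglongrightarrow> c *\<^sub>R x"
    by (intro tendsto_intros f)
  then show "c *\<^sub>R x \<in> closure V"
    unfolding closure_sequential using f(1) subspace_scale[OF assms]
    by (intro exI[of _ "\<lambda>n. c *\<^sub>R f n"]) auto
qed

lemma orthogonal_to_closure:
  fixes S :: "'v \<Rightarrow> 'a::real_inner"
  assumes "\<And>v. inner y (S v) = 0" and "u \<in> closure (range S)"
  shows "inner y u = 0"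
proof -
  have "closed {u. inner y u = 0}"
    by (intro closed_Collect_eq continuous_intros)
  then have "closure (range S) \<subseteq> {u. inner y u = 0}"
    using assms(1) by (intro closure_minimal) auto
  then show ?thesis using assms(2) by auto
qed

text \<open>The projection of \<open>y\<close> represents the functional \<open>v \<mapsto> \<langle>y, S v\<rangle>\<close>.\<close>

lemma orthogonal_projection_exists:
  fixes S :: "'v::real_vector \<Rightarrow> 'a::{real_inner,complete_space}"
  assumes "linear S"
  obtains p where "p \<in> closure (range S)" "\<And>v. inner (y - p) (S v) = 0"
proof -
  have "linear (\<lambda>v. inner y (S v))"
    by (intro linearI) (simp_all add: linear_add[OF assms] linear_scale[OF assms] inner_simps)
  then obtain p where "p \<in> closure (range S)" "\<And>v. inner y (S v) = inner p (S v)"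
    using dominated_functional_representation[OF assms, of "\<lambda>v. inner y (S v)" "norm y"]
    by (metis Cauchy_Schwarz_ineq2)
  then show thesis using that by (simp add: inner_diff_left)
qed

lemma bounded_linear_norm_bound:
  assumes "bounded_linear T"
  shows "\<exists>c>0. \<forall>x. norm (T x) \<le> c * norm x"
proof -
  obtain K where "K > 0" and K: "\<forall>x. norm (T x) \<le> norm x * K"
    using bounded_linear.pos_bounded[OF assms] by blast
  have "norm (T x) \<le> K * norm x" for x
    using K by (simp add: mult.commute)
  with \<open>K > 0\<close> show ?thesis by blast
qed

lemma real_adjoint_exists:
  fixes A :: "'a::{real_inner,complete_space} \<Rightarrow> 'b::real_inner"
  assumes A: "bounded_linear A"
  obtains A' where "bounded_linear A'" "\<And>x y. inner (A x) y = inner x (A' y)"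
proof -
  have lin: "linear A" using A by (rule bounded_linear.linear)
  from bounded_linear_norm_bound[OF A]
  obtain K where "K > 0 \<and> (\<forall>x. norm (A x) \<le> K * norm x)" ..
  then have "K > 0" and K: "\<And>x. norm (A x) \<le> K * norm x" by auto
  have "\<exists>w. \<forall>x. inner (A x) y = inner x w" for y
  proof -
    have "linear (\<lambda>x. inner (A x) y)"
      by (intro linearI) (simp_all add: linear_add[OF lin] linear_scale[OF lin] inner_simps)
    moreover have "\<bar>inner (A x) y\<bar> \<le> (K * norm y) * norm (id x)" for x
      using Cauchy_Schwarz_ineq2[of "A x" y] mult_right_mono[OF K[of x] norm_ge_zero[of y]]
      by (simp add: algebra_simps)
    ultimately obtain w where "\<And>x. inner (A x) y = inner w (id x)"
      using dominated_functional_representation[OF linear_id] by metis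
    then show ?thesis by (auto simp: inner_commute)
  qed
  then obtain A' where A': "\<And>x y. inner (A x) y = inner x (A' y)" by metis
  have "bounded_linear A'"
  proof (rule bounded_linear_intro)
    fix x y and r :: real
    show "A' (x + y) = A' x + A' y"
      by (rule vector_eq_ldot[THEN iffD1]) (simp add: A'[symmetric] inner_simps)
    show "A' (r *\<^sub>R x) = r *\<^sub>R A' x"
      by (rule vector_eq_ldot[THEN iffD1]) (simp add: A'[symmetric] inner_simps)
    have "(norm (A' x))\<^sup>2 = inner (A (A' x)) x"
      by (simp add: A' power2_norm_eq_inner)
    also have "\<dots> \<le> norm (A (A' x)) * norm x" by (rule norm_cauchy_schwarz)
    also have "\<dots> \<le> (K * norm (A' x)) * norm x" by (intro mult_right_mono K) simp
    finally have "norm (A' x) * norm (A' x) \<le> norm (A' x) * (norm x * K)"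
      by (simp add: power2_eq_square algebra_simps)
    then show "norm (A' x) \<le> norm x * K"
      using \<open>K > 0\<close> by (cases "A' x = 0") auto
  qed
  then show thesis by (rule that) (rule A')
qed

section \<open>Square roots of positive semidefinite operators\<close>

definition positive_semidefinite :: "('a::real_inner \<Rightarrow> 'a) \<Rightarrow> bool" where
  "positive_semidefinite T \<longleftrightarrow> bounded_linear T \<and> (\<forall>x y. inner (T x) y = inner x (T y))
     \<and> (\<forall>x. 0 \<le> inner (T x) x)"

text \<open>Evaluating the form at \<open>x - T x / c\<close> gives the Cauchy-Schwarz inequality for the semi-inner product
  \<open>\<langle>T x, y\<rangle>\<close> in the one case needed. It makes \<open>id - T / c\<close> a contraction, and it shows that a vector on
  which the form vanishes lies in the kernel of \<open>T\<close>.\<close>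

lemma positive_semidefinite_norm_bound:
  assumes T: "positive_semidefinite T" and c: "c > 0" "\<And>x. norm (T x) \<le> c * norm x"
  shows "(norm (T x))\<^sup>2 \<le> c * inner (T x) x"
proof -
  have lin: "linear T" and sym: "\<And>x y. inner (T x) y = inner x (T y)"
    and nonneg: "\<And>x. 0 \<le> inner (T x) x"
    using T by (auto simp: positive_semidefinite_def bounded_linear.linear)
  define y where "y = T x"
  have "0 \<le> inner (T (x - (1/c) *\<^sub>R y)) (x - (1/c) *\<^sub>R y)"
    by (rule nonneg)
  also have "\<dots> = inner (T x) x - 2 / c * inner y y + (1/c)\<^sup>2 * inner (T y) y"
    using sym[of y x]
    by (simp add: y_def linear_diff[OF lin] linear_scale[OF lin] inner_simps power2_eq_square inner_commute)
  finally have "0 \<le> c\<^sup>2 * (inner (T x) x - 2 / c * inner y y + (1/c)\<^sup>2 * inner (T y) y)"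
    by simp
  also have "\<dots> = c\<^sup>2 * inner (T x) x - 2 * c * inner y y + inner (T y) y"
    using c(1) by (simp add: field_simps power2_eq_square)
  also have "inner (T y) y \<le> c * inner y y"
  proof -
    have "inner (T y) y \<le> norm (T y) * norm y" by (rule norm_cauchy_schwarz)
    also have "\<dots> \<le> c * norm y * norm y" by (intro mult_right_mono c) simp
    finally show ?thesis by (simp add: power2_norm_eq_inner[symmetric] power2_eq_square)
  qed
  finally have "c * inner y y \<le> c * (c * inner (T x) x)"
    by (simp add: power2_eq_square algebra_simps)
  then show ?thesis using c(1) by (simp add: y_def power2_norm_eq_inner)
qed

lemma positive_semidefinite_form_zero:
  assumes T: "positive_semidefinite T" and "inner (T x) x = 0"
  shows "T x = 0"
proof -
  have "bounded_linear T"
    using T by (simp add: positive_semidefinite_def)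
  from bounded_linear_norm_bound[OF this]
  obtain c where "c > 0 \<and> (\<forall>x. norm (T x) \<le> c * norm x)" ..
  then have "c > 0" "\<And>x. norm (T x) \<le> c * norm x" by auto
  from positive_semidefinite_norm_bound[OF T this, of x] assms(2) show ?thesis by simp
qed

text \<open>If \<open>Y = (B + Y\<^sup>2) / 2\<close> then \<open>(1 - Y)\<^sup>2 = 1 - B\<close>, so a fixed point produces a square root of \<open>1 - B\<close>.
  Iterating from \<open>0\<close> converges in operator norm because it is majorised by the scalar iteration
  \<open>r \<mapsto> (1 + r\<^sup>2) / 2\<close>, which increases to \<open>1\<close>: norms of the iterates and of their increments are at most
  the scalar ones. A contraction argument would fail when \<open>B\<close> has norm exactly \<open>1\<close>.

  The second conjunct transfers to the fixed point any closed property that the iteration preserves;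
  it is applied to symmetry, to the norm bound, and to commutation with a given operator.\<close>

lemma quadratic_fixed_point:
  fixes B :: "'a::banach \<Rightarrow>\<^sub>L 'a"
  assumes B: "norm B \<le> 1"
  shows "\<exists>Y. Y = (1/2) *\<^sub>R (B + (Y o\<^sub>L Y)) \<and>
    (\<forall>C. closed C \<and> 0 \<in> C \<and> (\<forall>Z\<in>C. (1/2) *\<^sub>R (B + (Z o\<^sub>L Z)) \<in> C) \<longrightarrow> Y \<in> C)"
proof -
  define G where "G Z = (1/2) *\<^sub>R (B + (Z o\<^sub>L Z))" for Z
  define Y where "Y n = (G ^^ n) 0" for n
  define y where "y n = ((\<lambda>r::real. (1 + r\<^sup>2) / 2) ^^ n) 0" for n
  have Y_Suc: "Y (Suc n) = G (Y n)" and y_Suc: "y (Suc n) = (1 + (y n)\<^sup>2) / 2" for n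
    by (simp_all add: Y_def y_def)
  have y01: "0 \<le> y n \<and> y n \<le> 1" for n
  proof (induction n)
    case (Suc n)
    then have "(y n)\<^sup>2 \<le> 1\<^sup>2" by (intro power_mono) auto
    then show ?case by (simp add: y_Suc)
  qed (simp add: y_def)
  have y_le: "y n \<le> y (Suc n)" for n
    using zero_le_power2[of "1 - y n"] by (simp add: y_Suc power2_diff)
  have normG: "norm (G Z) \<le> (1 + r\<^sup>2) / 2" if "norm Z \<le> r" for Z r
  proof -
    have "norm (B + (Z o\<^sub>L Z)) \<le> 1 + r\<^sup>2"
      using norm_triangle_ineq[of B "Z o\<^sub>L Z"] norm_blinfun_compose[of Z Z] B
        mult_mono[OF that that] order_trans[OF norm_ge_zero that] norm_ge_zero[of Z]
      by (simp add: power2_eq_square)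
    then show ?thesis by (simp add: G_def)
  qed
  have normY: "norm (Y n) \<le> y n" for n
  proof (induction n)
    case (Suc n)
    then show ?case using normG by (simp add: Y_Suc y_Suc)
  qed (simp add: Y_def y_def)
  have step: "norm (Y (Suc n) - Y n) \<le> y (Suc n) - y n" for n
  proof (induction n)
    case 0
    then show ?case using normY[of "Suc 0"] by (simp add: Y_def y_def)
  next
    case (Suc n)
    define D where "D = Y (Suc n) - Y n"
    \<comment> \<open>A difference of squares, arranged so that no commutation of the iterates is required.\<close>
    have "G (Y (Suc n)) - G (Y n) = (1/2) *\<^sub>R ((D o\<^sub>L Y (Suc n)) + (Y n o\<^sub>L D))"
      unfolding G_def D_def
      by (simp add: bounded_bilinear.diff_left[OF bounded_bilinear_blinfun_compose]
          bounded_bilinear.diff_right[OF bounded_bilinear_blinfun_compose] algebra_simps)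
    moreover have "norm ((D o\<^sub>L Y (Suc n)) + (Y n o\<^sub>L D)) \<le> (y (Suc n) - y n) * (y (Suc n) + y n)"
    proof -
      have "norm (D o\<^sub>L Y (Suc n)) \<le> (y (Suc n) - y n) * y (Suc n)"
        using Suc normY[of "Suc n"] y_le[of n] unfolding D_def
        by (intro order_trans[OF norm_blinfun_compose] mult_mono) auto
      moreover have "norm (Y n o\<^sub>L D) \<le> y n * (y (Suc n) - y n)"
        using Suc normY[of n] y01[of n] unfolding D_def
        by (intro order_trans[OF norm_blinfun_compose] mult_mono) auto
      ultimately show ?thesis
        using norm_triangle_ineq[of "D o\<^sub>L Y (Suc n)" "Y n o\<^sub>L D"] by (simp add: algebra_simps)
    qed
    ultimately have "norm (G (Y (Suc n)) - G (Y n)) \<le> (y (Suc n) - y n) * (y (Suc n) + y n) / 2"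
      by simp
    also have "\<dots> = y (Suc (Suc n)) - y (Suc n)"
    proof -
      have "y (Suc (Suc n)) - y (Suc n) = ((y (Suc n))\<^sup>2 - (y n)\<^sup>2) / 2"
        using y_Suc[of "Suc n"] y_Suc[of n] by (simp add: diff_divide_distrib add_divide_distrib)
      moreover have "(y (Suc n) - y n) * (y (Suc n) + y n) = (y (Suc n))\<^sup>2 - (y n)\<^sup>2"
        by (simp add: algebra_simps power2_eq_square)
      ultimately show ?thesis by simp
    qed
    finally show ?case by (simp add: Y_Suc)
  qed
  have "summable (\<lambda>n. y (Suc n) - y n)"
  proof -
    have "convergent y"
    proof (rule Bseq_mono_convergent)
      show "Bseq y" using y01 by (intro BseqI'[of _ 1]) auto
      show "\<forall>i. \<forall>j\<ge>i. y i \<le> y j"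
        using lift_Suc_mono_le[of y] y_le by blast
    qed
    then show ?thesis
      using telescope_summable by (auto simp: convergent_def)
  qed
  then have "summable (\<lambda>n. Y (Suc n) - Y n)"
    by (rule summable_comparison_test'[where N = 0]) (rule step)
  then have "convergent (\<lambda>n. \<Sum>i<n. Y (Suc i) - Y i)"
    by (simp add: summable_iff_convergent)
  moreover have "(\<lambda>n. \<Sum>i<n. Y (Suc i) - Y i) = Y"
    by (rule ext) (simp add: sum_lessThan_telescope, simp add: Y_def)
  ultimately obtain L where L: "Y \<longlonglongrightarrow> L"
    by (auto simp: convergent_def)
  show ?thesis
  proof (intro exI[of _ L] conjI allI impI)
    have "(\<lambda>n. G (Y n)) \<longlonglongrightarrow> G L"
      unfolding G_def by (intro tendsto_intros bounded_bilinear.tendsto[OF bounded_bilinear_blinfun_compose] L)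
    moreover have "(\<lambda>n. G (Y n)) \<longlonglongrightarrow> L"
      using LIMSEQ_Suc[OF L] by (simp add: Y_Suc)
    ultimately show "L = (1/2) *\<^sub>R (B + (L o\<^sub>L L))"
      unfolding G_def by (rule LIMSEQ_unique[rotated])
  next
    fix C assume "closed C \<and> 0 \<in> C \<and> (\<forall>Z\<in>C. (1/2) *\<^sub>R (B + (Z o\<^sub>L Z)) \<in> C)"
    then have "closed C" "0 \<in> C" and inv: "\<And>Z. Z \<in> C \<Longrightarrow> (1/2) *\<^sub>R (B + (Z o\<^sub>L Z)) \<in> C"
      by auto
    have "Y n \<in> C" for n
    proof (induction n)
      case (Suc n)
      then show ?case using inv by (simp add: Y_Suc G_def)
    qed (simp add: Y_def \<open>0 \<in> C\<close>)
    then show "L \<in> C"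
      using closed_sequentially[OF \<open>closed C\<close> _ L] by simp
  qed
qed

text \<open>After scaling by a norm bound \<open>c\<close> the operator is \<open>c (1 - B)\<close> with \<open>\<parallel>B\<parallel> \<le> 1\<close>, and the root is
  \<open>\<surd>c (1 - Y)\<close> for the fixed point \<open>Y\<close>. The last conclusion, that the root commutes with whatever commutes
  with \<open>T\<close>, is needed twice: for uniqueness of the root and, applied to multiplication by complex scalars,
  for its complex linearity.\<close>

lemma positive_semidefinite_sqrt_exists:
  fixes T :: "'a::{real_inner,banach} \<Rightarrow> 'a"
  assumes T: "positive_semidefinite T"
  obtains S where "positive_semidefinite S" "S \<circ> S = T"
    "\<And>R. bounded_linear R \<Longrightarrow> R \<circ> T = T \<circ> R \<Longrightarrow> R \<circ> S = S \<circ> R"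
proof -
  have bl: "bounded_linear T" and sym: "\<And>x y. inner (T x) y = inner x (T y)"
    and nonneg: "\<And>x. 0 \<le> inner (T x) x"
    using T unfolding positive_semidefinite_def by blast+
  from bounded_linear_norm_bound[OF bl]
  obtain c where "c > 0 \<and> (\<forall>x. norm (T x) \<le> c * norm x)" ..
  then have c: "c > 0" "\<And>x. norm (T x) \<le> c * norm x" by auto
  define B where "B = id_blinfun - (1/c) *\<^sub>R Blinfun T"
  have B_apply: "blinfun_apply B x = x - (1/c) *\<^sub>R T x" for x
    by (simp add: B_def blinfun.diff_left blinfun.scaleR_left bounded_linear_Blinfun_apply[OF bl])
  have "norm B \<le> 1"
  proof (rule norm_blinfun_bound)
    fix x
    have "(norm (B x))\<^sup>2 = (norm x)\<^sup>2 - 2 / c * inner (T x) x + (norm (T x))\<^sup>2 / c\<^sup>2"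
      unfolding power2_norm_eq_inner B_apply
      using c(1) by (simp add: inner_simps inner_commute field_simps power2_eq_square)
    also have "\<dots> \<le> (norm x)\<^sup>2 - 2 / c * inner (T x) x + c * inner (T x) x / c\<^sup>2"
      using positive_semidefinite_norm_bound[OF T c, of x] by (simp add: divide_right_mono)
    also have "\<dots> = (norm x)\<^sup>2 - inner (T x) x / c"
      using c(1) by (simp add: field_simps power2_eq_square)
    also have "\<dots> \<le> (norm x)\<^sup>2"
      using nonneg[of x] c(1) by simp
    finally have "norm (B x) \<le> norm x" by (rule power2_le_imp_le) simp
    then show "norm (B x) \<le> 1 * norm x" by simp
  qed simp
  from quadratic_fixed_point[OF this] obtain Y where
    fixed: "Y = (1/2) *\<^sub>R (B + (Y o\<^sub>L Y)) \<and>
      (\<forall>C. closed C \<and> 0 \<in> C \<and> (\<forall>Z\<in>C. (1/2) *\<^sub>R (B + (Z o\<^sub>L Z)) \<in> C) \<longrightarrow> Y \<in> C)" ..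
  note Y = conjunct1[OF fixed]
  have Y_in: "Y \<in> C"
    if "closed C" "0 \<in> C" "\<And>Z. Z \<in> C \<Longrightarrow> (1/2) *\<^sub>R (B + (Z o\<^sub>L Z)) \<in> C" for C
    using conjunct2[OF fixed] that by blast
  have Y_sym: "inner (Y x) z = inner x (Y z)" for x z
  proof -
    have "Y \<in> {Z. \<forall>x z. inner (blinfun_apply Z x) z = inner x (blinfun_apply Z z)}"
    proof (rule Y_in)
      show "closed {Z::'a \<Rightarrow>\<^sub>L 'a. \<forall>x z. inner (blinfun_apply Z x) z = inner x (blinfun_apply Z z)}"
        by (intro closed_Collect_all closed_Collect_eq continuous_intros)
    qed (auto simp: blinfun.add_left blinfun.scaleR_left B_apply inner_simps sym)
    then show ?thesis by simp
  qed
  have "Y \<in> cball 0 1"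
  proof (rule Y_in)
    fix Z :: "'a \<Rightarrow>\<^sub>L 'a" assume "Z \<in> cball 0 1"
    then have "norm (Z o\<^sub>L Z) \<le> 1"
      using norm_blinfun_compose[of Z Z] mult_mono[of "norm Z" 1 "norm Z" 1] by auto
    then show "(1/2) *\<^sub>R (B + (Z o\<^sub>L Z)) \<in> cball 0 1"
      using norm_triangle_ineq[of B "Z o\<^sub>L Z"] \<open>norm B \<le> 1\<close> by simp
  qed auto
  then have Y_le: "inner (Y x) x \<le> inner x x" for x
  proof -
    have "inner (Y x) x \<le> norm (Y x) * norm x" by (rule norm_cauchy_schwarz)
    also have "\<dots> \<le> 1 * norm x * norm x"
      using \<open>Y \<in> cball 0 1\<close> norm_blinfun[of Y x] mult_right_mono[of "norm Y" 1 "norm x"]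
      by (intro mult_right_mono) auto
    finally show ?thesis by (simp add: power2_norm_eq_inner[symmetric] power2_eq_square)
  qed
  have Y_comm: "R (Y x) = Y (R x)" if R: "bounded_linear R" "R \<circ> T = T \<circ> R" for R x
  proof -
    interpret R: bounded_linear R by fact
    have RT: "R (T x) = T (R x)" for x using fun_cong[OF R(2)] by simp
    have "Y \<in> {Z. \<forall>x. R (blinfun_apply Z x) = blinfun_apply Z (R x)}"
    proof (rule Y_in)
      show "closed {Z::'a \<Rightarrow>\<^sub>L 'a. \<forall>x. R (blinfun_apply Z x) = blinfun_apply Z (R x)}"
        by (intro closed_Collect_all closed_Collect_eq R.continuous_on continuous_intros)
    qed (auto simp: blinfun.add_left blinfun.scaleR_left B_apply RT R.add R.diff R.scaleR R.zero)
    then show ?thesis by simp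
  qed
  have Y_fix: "2 *\<^sub>R Y x - Y (Y x) = x - (1/c) *\<^sub>R T x" for x
  proof -
    have "Y x = (1/2) *\<^sub>R (B x + Y (Y x))"
      using arg_cong[OF Y, of "\<lambda>Z. blinfun_apply Z x"] by (simp add: blinfun.add_left blinfun.scaleR_left)
    then have "2 *\<^sub>R Y x = B x + Y (Y x)"
      by (metis (no_types) scaleR_scaleR scaleR_one nonzero_divide_eq_eq zero_neq_numeral mult.commute)
    then show ?thesis by (simp add: B_apply)
  qed
  define S where "S x = sqrt c *\<^sub>R (x - Y x)" for x
  show thesis
  proof
    show "positive_semidefinite S"
      unfolding positive_semidefinite_def
    proof (intro conjI allI)
      show "bounded_linear S"
        unfolding S_def by (intro bounded_linear_intros)
      show "inner (S x) z = inner x (S z)" for x z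
        by (simp add: S_def inner_simps Y_sym)
      show "0 \<le> inner (S x) x" for x
        using Y_le[of x] c(1) by (simp add: S_def inner_simps)
    qed
    show "S \<circ> S = T"
    proof
      fix x
      have "(S \<circ> S) x = (sqrt c * sqrt c) *\<^sub>R (x - (2 *\<^sub>R Y x - Y (Y x)))"
        by (simp add: S_def blinfun.diff_right blinfun.scaleR_right scaleR_diff_right
            scaleR_2 scaleR_add_right)
      then show "(S \<circ> S) x = T x"
        using c(1) by (simp add: Y_fix)
    qed
    fix R :: "'a \<Rightarrow> 'a" assume R: "bounded_linear R" "R \<circ> T = T \<circ> R"
    then interpret R: bounded_linear R by simp
    show "R \<circ> S = S \<circ> R"
      by (rule ext) (simp add: S_def R.scaleR R.diff Y_comm[OF R])
  qed
qed

text \<open>Put \<open>y = (P - Q) x\<close>. Commutation turns \<open>P\<^sup>2 = Q\<^sup>2\<close> into \<open>(P + Q) y = 0\<close>, so the two nonnegative numbers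
  \<open>\<langle>P y, y\<rangle>\<close> and \<open>\<langle>Q y, y\<rangle>\<close> add up to zero. Hence \<open>P y = Q y = 0\<close> and
  \<open>\<parallel>y\<parallel>\<^sup>2 = \<langle>x, (P - Q) y\<rangle> = 0\<close>.\<close>

lemma positive_semidefinite_sqrt_unique:
  assumes P: "positive_semidefinite P" and Q: "positive_semidefinite Q"
    and sq: "P \<circ> P = Q \<circ> Q" and comm: "Q \<circ> P = P \<circ> Q"
  shows "P = Q"
proof
  fix x
  have linP: "linear P" and linQ: "linear Q"
    using P Q by (auto simp: positive_semidefinite_def bounded_linear.linear)
  have sq': "P (P z) = Q (Q z)" and comm': "Q (P z) = P (Q z)" for z
    using fun_cong[OF sq, of z] fun_cong[OF comm, of z] by auto
  define y where "y = P x - Q x"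
  have "P y + Q y = 0"
    by (simp add: y_def linear_diff[OF linP] linear_diff[OF linQ] sq' comm')
  then have "inner (P y) y + inner (Q y) y = 0"
    by (metis inner_add_left inner_zero_left)
  moreover have "0 \<le> inner (P y) y" "0 \<le> inner (Q y) y"
    using P Q unfolding positive_semidefinite_def by blast+
  ultimately have "inner (P y) y = 0" "inner (Q y) y = 0" by linarith+
  then have "P y = 0" "Q y = 0"
    using positive_semidefinite_form_zero[OF P] positive_semidefinite_form_zero[OF Q] by blast+
  moreover have "inner y y = inner x (P y) - inner x (Q y)"
    using P Q by (simp add: y_def inner_diff_left positive_semidefinite_def)
  ultimately show "P x = Q x" by (simp add: y_def)
qed

section \<open>From real to complex scalars\<close>

instance complex_hilbert \<subseteq> banach ..

lemma scaleC_minus_left: "(- c) *\<^sub>C x = - (c *\<^sub>C x)" for x :: "'a::complex_vector"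
proof -
  have "(- c) *\<^sub>C x = (-1::real) *\<^sub>R c *\<^sub>C x"
    unfolding scaleR_scaleC scaleC_scaleC by simp
  then show ?thesis by simp
qed

lemma inner_scaleC_left:
  fixes x y :: "'a::complex_inner"
  shows "inner (c *\<^sub>C x) y = inner x (cnj c *\<^sub>C y)"
proof -
  have "cinner (c *\<^sub>C x) y = cinner x (cnj c *\<^sub>C y)"
    using cinner_commute[of x "cnj c *\<^sub>C y"] cinner_commute[of x y]
    by (simp add: cinner_scaleC_left)
  then show ?thesis by (metis Re_cinner)
qed

lemma Im_cinner:
  fixes x y :: "'a::complex_inner"
  shows "Im (cinner x y) = - inner (\<i> *\<^sub>C x) y"
  by (simp add: Re_cinner[symmetric] cinner_scaleC_left)

lemma bounded_linear_scaleC: "bounded_linear (\<lambda>x::'a::complex_inner. c *\<^sub>C x)"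
proof (rule bounded_linear_intro)
  fix x y :: 'a and r :: real
  show "c *\<^sub>C (x + y) = c *\<^sub>C x + c *\<^sub>C y" by (rule scaleC_add_right)
  show "c *\<^sub>C r *\<^sub>R x = r *\<^sub>R c *\<^sub>C x"
    by (simp add: scaleR_scaleC scaleC_scaleC mult.commute)
  have "cnj c *\<^sub>C c *\<^sub>C x = ((cmod c)\<^sup>2) *\<^sub>R x"
    by (simp only: scaleC_scaleC scaleR_scaleC complex_norm_square mult.commute)
  then have "(norm (c *\<^sub>C x))\<^sup>2 = (norm x * cmod c)\<^sup>2"
    unfolding power2_norm_eq_inner by (simp add: inner_scaleC_left power_mult_distrib power2_norm_eq_inner)
  then show "norm (c *\<^sub>C x) \<le> norm x * cmod c" by (simp add: power2_eq_iff_nonneg)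
qed

text \<open>A complex-linear operator with real quadratic form is symmetric: the imaginary part of the form at
  \<open>\<i> x + y\<close> vanishes, and its mixed terms are the difference of the two sides of the symmetry. Conversely,
  symmetry of a complex-linear operator makes the form real. So complex positivity adds to the real
  notion only linearity over the complex scalars.\<close>

lemma positive_op_iff:
  fixes T :: "'a::complex_hilbert \<Rightarrow> 'a"
  shows "positive_op T \<longleftrightarrow> positive_semidefinite T \<and> (\<forall>c x. T (c *\<^sub>C x) = c *\<^sub>C T x)"
proof
  assume "positive_op T"
  then have bl: "bounded_linear T" and cl: "\<And>c x. T (c *\<^sub>C x) = c *\<^sub>C T x"
    and pos: "\<And>x. cinner (T x) x \<in> \<real>\<^sub>\<ge>\<^sub>0"
    by (auto simp: positive_op_def bounded_clinear_def)
  have add: "T (x + y) = T x + T y" for x y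
    using bl by (simp add: bounded_linear.linear linear_add)
  have Im0: "inner (\<i> *\<^sub>C T x) x = 0" for x
    using pos[of x] Im_cinner[of "T x" x] by (auto simp: nonneg_Reals_def)
  have "inner (T x) y = inner x (T y)" for x y
  proof -
    have "inner (\<i> *\<^sub>C T (\<i> *\<^sub>C x + y)) (\<i> *\<^sub>C x + y) = 0" by (rule Im0)
    then have "inner (\<i> *\<^sub>C T (\<i> *\<^sub>C x)) y + inner (\<i> *\<^sub>C T y) (\<i> *\<^sub>C x) = 0"
      using Im0[of "\<i> *\<^sub>C x"] Im0[of y] by (simp add: add scaleC_add_right inner_simps)
    moreover have "inner (\<i> *\<^sub>C T (\<i> *\<^sub>C x)) y = - inner (T x) y"
      by (simp add: cl scaleC_scaleC scaleC_minus_left scaleC_one)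
    moreover have "inner (\<i> *\<^sub>C T y) (\<i> *\<^sub>C x) = inner (T y) x"
      by (simp add: inner_scaleC_left scaleC_scaleC scaleC_one)
    ultimately show ?thesis by (simp add: inner_commute)
  qed
  moreover have "0 \<le> inner (T x) x" for x
    using pos[of x] Re_cinner[of "T x" x] by (auto simp: nonneg_Reals_def)
  ultimately show "positive_semidefinite T \<and> (\<forall>c x. T (c *\<^sub>C x) = c *\<^sub>C T x)"
    using bl cl by (simp add: positive_semidefinite_def)
next
  assume T: "positive_semidefinite T \<and> (\<forall>c x. T (c *\<^sub>C x) = c *\<^sub>C T x)"
  then have sym: "\<And>x y. inner (T x) y = inner x (T y)" and cl: "\<And>c x. T (c *\<^sub>C x) = c *\<^sub>C T x"
    and nonneg: "\<And>x. 0 \<le> inner (T x) x"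
    by (auto simp: positive_semidefinite_def)
  have "cinner (T x) x \<in> \<real>\<^sub>\<ge>\<^sub>0" for x
  proof -
    have "inner (\<i> *\<^sub>C T x) x = inner (T x) ((- \<i>) *\<^sub>C x)"
      by (simp add: inner_scaleC_left)
    also have "\<dots> = inner x (- (\<i> *\<^sub>C T x))"
      by (simp add: sym cl scaleC_minus_left[of \<i>, symmetric])
    finally have "inner (\<i> *\<^sub>C T x) x = 0" by (simp add: inner_commute)
    then have "Im (cinner (T x) x) = 0" by (simp add: Im_cinner)
    then show ?thesis
      using nonneg by (simp add: complex_nonneg_Reals_iff Re_cinner)
  qed
  then show "positive_op T"
    using T by (simp add: positive_op_def bounded_clinear_def positive_semidefinite_def)
qed

text \<open>Any positive root \<open>Q\<close> commutes with \<open>T = Q\<^sup>2\<close>, hence with the root \<open>S\<close> constructed above, so \<open>Q = S\<close>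
  and the definite description denotes \<open>S\<close>.\<close>

lemma sqrt_op_properties:
  fixes T :: "'a::complex_hilbert \<Rightarrow> 'a"
  assumes "positive_op T"
  shows "positive_op (sqrt_op T)" "sqrt_op T \<circ> sqrt_op T = T"
proof -
  from assms have T: "positive_semidefinite T" and cl: "\<And>c x. T (c *\<^sub>C x) = c *\<^sub>C T x"
    by (auto simp: positive_op_iff)
  obtain S where S: "positive_semidefinite S" "S \<circ> S = T"
    and comm: "\<And>R. bounded_linear R \<Longrightarrow> R \<circ> T = T \<circ> R \<Longrightarrow> R \<circ> S = S \<circ> R"
    using positive_semidefinite_sqrt_exists[OF T] by blast
  have "S (c *\<^sub>C x) = c *\<^sub>C S x" for c x
    using fun_cong[OF comm[OF bounded_linear_scaleC[of c]], of x] cl by (auto simp: fun_eq_iff)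
  then have pos: "positive_op S" using S by (simp add: positive_op_iff)
  have *: "Q = S" if Q: "positive_op Q" "Q \<circ> Q = T" for Q
  proof -
    have "positive_semidefinite Q" using Q(1) by (simp add: positive_op_iff)
    moreover have "Q \<circ> S = S \<circ> Q"
    proof (rule comm)
      show "bounded_linear Q" using calculation by (simp add: positive_semidefinite_def)
      show "Q \<circ> T = T \<circ> Q" unfolding Q(2)[symmetric] by (simp add: comp_assoc)
    qed
    ultimately show ?thesis
      using positive_semidefinite_sqrt_unique[of S Q] S Q(2) by simp
  qed
  have "positive_op (sqrt_op T) \<and> sqrt_op T \<circ> sqrt_op T = T"
    unfolding sqrt_op_def
  proof (intro theI[where P = "\<lambda>S. positive_op S \<and> S \<circ> S = T"])
    show "positive_op S \<and> S \<circ> S = T" using pos S(2) by (rule conjI)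
  qed (rule *, auto)
  then show "positive_op (sqrt_op T)" "sqrt_op T \<circ> sqrt_op T = T" by auto
qed

lemma real_adjoint_antilinear:
  fixes A A' :: "'a::complex_inner \<Rightarrow> 'a"
  assumes A: "\<And>c x. A (c *\<^sub>C x) = cnj c *\<^sub>C A x"
    and adj: "\<And>x y. inner (A x) y = inner x (A' y)"
  shows "A' (c *\<^sub>C x) = cnj c *\<^sub>C A' x"
proof (rule vector_eq_ldot[THEN iffD1], rule allI)
  fix z
  have "inner z (A' (c *\<^sub>C x)) = inner (A (c *\<^sub>C z)) x"
    using inner_scaleC_left[of c x "A z"] by (simp add: adj[symmetric] A inner_commute)
  then show "inner z (A' (c *\<^sub>C x)) = inner z (cnj c *\<^sub>C A' x)"
    by (simp add: adj inner_scaleC_left)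
qed

text \<open>The conjugate in the defining equation \<open>\<langle>A x, y\<rangle> = cnj \<langle>x, Y y\<rangle>\<close> does not affect real parts, so the
  anti-linear adjoint can only be the adjoint for the real inner product. The imaginary parts then agree
  because \<open>A (\<i> x) = - \<i> A x\<close>.\<close>

lemma antilinear_adjoint_properties:
  fixes A :: "'a::complex_hilbert \<Rightarrow> 'a"
  assumes "bounded_antilinear A"
  shows "bounded_antilinear (antilinear_adjoint A)"
    "inner (A x) y = inner x (antilinear_adjoint A y)"
proof -
  let ?adj = "\<lambda>Y. bounded_antilinear Y \<and> (\<forall>x y. cinner (A x) y = cnj (cinner x (Y y)))"
  from assms have bl: "bounded_linear A" and al: "\<And>c x. A (c *\<^sub>C x) = cnj c *\<^sub>C A x"
    by (auto simp: bounded_antilinear_def)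
  have inner_eq: "inner (A x) y = inner x (Y y)" if "?adj Y" for Y x y
    using that by (metis Re_cinner complex_cnj(1) cnj.simps(1))
  obtain A' where A': "bounded_linear A'" "\<And>x y. inner (A x) y = inner x (A' y)"
    using real_adjoint_exists[OF bl] by blast
  have "?adj A'"
  proof (intro conjI allI)
    show "bounded_antilinear A'"
      using A' real_adjoint_antilinear[OF al A'(2)] by (simp add: bounded_antilinear_def)
    fix x y
    have "inner (\<i> *\<^sub>C A x) y = - inner (\<i> *\<^sub>C x) (A' y)"
      using A'(2)[of "(- \<i>) *\<^sub>C x" y] al[of "- \<i>" x] by (simp add: scaleC_minus_left)
    then show "cinner (A x) y = cnj (cinner x (A' y))"
      by (simp add: complex_eq_iff Re_cinner Im_cinner A'(2))
  qed
  moreover have "Y = A'" if "?adj Y" for Y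
  proof
    fix y show "Y y = A' y"
      by (rule vector_eq_ldot[THEN iffD1]) (metis inner_eq[OF that] A'(2))
  qed
  ultimately have "?adj (antilinear_adjoint A)"
    unfolding antilinear_adjoint_def by (rule theI)
  then show "bounded_antilinear (antilinear_adjoint A)"
    "inner (A x) y = inner x (antilinear_adjoint A y)"
    using inner_eq by auto
qed

lemma antilinear_abs_properties:
  fixes A :: "'a::complex_hilbert \<Rightarrow> 'a"
  assumes A: "bounded_antilinear A"
  shows "positive_op (antilinear_abs A)" "norm (antilinear_abs A x) = norm (A x)"
proof -
  let ?T = "antilinear_adjoint A \<circ> A"
  note adj = antilinear_adjoint_properties[OF A]
  have "bounded_linear ?T"
    using A adj(1) by (auto simp: bounded_antilinear_def comp_def intro: bounded_linear_compose)
  moreover have "inner (?T x) y = inner x (?T y)" for x y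
    using adj(2)[of y "A x"] adj(2)[of x "A y"] by (simp add: inner_commute)
  moreover have form: "inner (?T x) x = (norm (A x))\<^sup>2" for x
    using adj(2)[of x "A x"] by (simp add: inner_commute power2_norm_eq_inner)
  moreover have "?T (c *\<^sub>C x) = c *\<^sub>C ?T x" for c x
    using A adj(1) by (simp add: bounded_antilinear_def)
  ultimately have "positive_op ?T"
    by (simp add: positive_op_iff positive_semidefinite_def del: comp_apply)
  from sqrt_op_properties[OF this]
  have pos: "positive_op (antilinear_abs A)" and sq: "antilinear_abs A \<circ> antilinear_abs A = ?T"
    by (auto simp: antilinear_abs_def)
  show "positive_op (antilinear_abs A)" by fact
  have "(norm (antilinear_abs A x))\<^sup>2 = inner ((antilinear_abs A \<circ> antilinear_abs A) x) x"
    using pos by (simp add: positive_op_iff positive_semidefinite_def power2_norm_eq_inner)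
  then have "(norm (antilinear_abs A x))\<^sup>2 = (norm (A x))\<^sup>2"
    unfolding sq form .
  then show "norm (antilinear_abs A x) = norm (A x)" by (rule power2_eq_imp_eq) simp_all
qed

section \<open>Polar decomposition\<close>

text \<open>Representing \<open>x \<mapsto> \<langle>A x, z\<rangle>\<close> as \<open>x \<mapsto> \<langle>K z, S x\<rangle>\<close> defines an operator \<open>K\<close> whose adjoint \<open>J\<close> satisfies
  \<open>\<langle>J (S x), z\<rangle> = \<langle>A x, z\<rangle>\<close> for the real inner product. Since the values of \<open>K\<close> lie in the closure of the
  range of \<open>S\<close>, its adjoint vanishes on the orthogonal complement of that range.\<close>

lemma antilinear_factorization:
  fixes A S :: "'a::complex_hilbert \<Rightarrow> 'a"
  assumes A: "bounded_antilinear A" and S: "positive_op S" and norm_eq: "\<And>x. norm (S x) = norm (A x)"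
  obtains J where "bounded_antilinear J" "\<And>x. J (S x) = A x"
    "\<And>y. (\<And>x. inner y (S x) = 0) \<Longrightarrow> J y = 0"
proof -
  have linA: "linear A" and al: "\<And>c x. A (c *\<^sub>C x) = cnj c *\<^sub>C A x"
    using A by (auto simp: bounded_antilinear_def bounded_linear.linear)
  have linS: "linear S" and cl: "\<And>c x. S (c *\<^sub>C x) = c *\<^sub>C S x"
    using S by (auto simp: positive_op_iff positive_semidefinite_def bounded_linear.linear)
  let ?M = "closure (range S)"
  have "\<exists>w. w \<in> ?M \<and> (\<forall>x. inner (A x) z = inner w (S x))" for z
  proof -
    have "linear (\<lambda>x. inner (A x) z)"
      by (intro linearI) (simp_all add: linear_add[OF linA] linear_scale[OF linA] inner_simps)
    moreover have "\<bar>inner (A x) z\<bar> \<le> norm z * norm (S x)" for x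
      using Cauchy_Schwarz_ineq2[of "A x" z] by (simp add: norm_eq mult.commute)
    ultimately show ?thesis
      using dominated_functional_representation[OF linS, of "\<lambda>x. inner (A x) z" "norm z"] by metis
  qed
  then obtain K where KM: "\<And>z. K z \<in> ?M" and K: "\<And>x z. inner (A x) z = inner (K z) (S x)"
    by metis
  have subM: "subspace ?M"
    by (rule subspace_closure[OF linear_subspace_image[OF linS subspace_UNIV]])
  have KI: "K z = w" if "w \<in> ?M" "\<And>x. inner (A x) z = inner w (S x)" for z w
  proof -
    have "inner (K z - w) (S x) = 0" for x
      using that(2)[of x] K[of x z] by (simp add: inner_diff_left)
    moreover have "K z - w \<in> ?M"
      by (rule subspace_diff[OF subM KM that(1)])
    ultimately have "inner (K z - w) (K z - w) = 0"
      by (rule orthogonal_to_closure)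
    then show ?thesis by simp
  qed
  have scaleC_M: "c *\<^sub>C w \<in> ?M" if "w \<in> ?M" for c w
  proof -
    have "(\<lambda>x. c *\<^sub>C x) ` ?M \<subseteq> ?M"
    proof (rule image_closure_subset)
      show "continuous_on ?M (\<lambda>x. c *\<^sub>C x)"
        by (intro linear_continuous_on bounded_linear_scaleC)
      show "(\<lambda>x. c *\<^sub>C x) ` range S \<subseteq> ?M"
        using closure_subset[of "range S"] by (auto simp: cl[symmetric])
    qed simp
    then show ?thesis using that by auto
  qed
  have K_al: "K (c *\<^sub>C z) = cnj c *\<^sub>C K z" for c z
  proof (rule KI)
    show "cnj c *\<^sub>C K z \<in> ?M" by (intro scaleC_M KM)
    fix x
    have "inner (A x) (c *\<^sub>C z) = inner (A (c *\<^sub>C x)) z"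
      by (simp add: al inner_scaleC_left)
    also have "\<dots> = inner (cnj c *\<^sub>C K z) (S x)"
      by (simp add: K cl inner_scaleC_left)
    finally show "inner (A x) (c *\<^sub>C z) = inner (cnj c *\<^sub>C K z) (S x)" .
  qed
  have K_le: "norm (K z) \<le> norm z" for z
  proof -
    have "closed {u. inner (K z) u \<le> norm z * norm u}"
      by (intro closed_Collect_le continuous_intros)
    moreover have "inner (K z) (S x) \<le> norm z * norm (S x)" for x
      using norm_cauchy_schwarz[of "A x" z] by (simp add: K[symmetric] norm_eq mult.commute)
    ultimately have "?M \<subseteq> {u. inner (K z) u \<le> norm z * norm u}"
      by (intro closure_minimal) auto
    then have "inner (K z) (K z) \<le> norm z * norm (K z)" using KM by auto
    then have "norm (K z) * norm (K z) \<le> norm z * norm (K z)"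
      by (simp add: power2_norm_eq_inner[symmetric] power2_eq_square)
    then show ?thesis by (cases "K z = 0") auto
  qed
  have "bounded_linear K"
  proof (rule bounded_linear_intro[where K = 1])
    show "K (x + y) = K x + K y" for x y
      by (rule KI) (auto simp: subspace_add[OF subM] KM inner_simps K)
    show "K (r *\<^sub>R x) = r *\<^sub>R K x" for r x
      by (rule KI) (auto simp: subspace_scale[OF subM] KM inner_simps K)
  qed (simp add: K_le)
  then obtain J where J: "bounded_linear J" "\<And>x y. inner (K x) y = inner x (J y)"
    using real_adjoint_exists by blast
  show thesis
  proof
    show "bounded_antilinear J"
      using J real_adjoint_antilinear[OF K_al J(2)] by (simp add: bounded_antilinear_def)
    show "J (S x) = A x" for x
      by (rule vector_eq_ldot[THEN iffD1]) (simp add: J(2)[symmetric] K[symmetric] inner_commute)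
    show "J y = 0" if "\<And>x. inner y (S x) = 0" for y
    proof -
      have "inner y (K (J y)) = 0" using that KM by (rule orthogonal_to_closure)
      then show ?thesis using J(2)[of "J y" y] by (simp add: inner_commute)
    qed
  qed
qed

theorem theorem3p3:
  fixes A :: "'a::complex_hilbert \<Rightarrow> 'a"
  assumes "separable_space (euclidean :: 'a topology)"
    and "bounded_antilinear A"
  shows "\<exists>!J :: 'a \<Rightarrow> 'a.
           antilinear_partial_isometry J \<and> A = J \<circ> antilinear_abs A \<and> op_kernel J = op_kernel A"
proof -
  define S where "S = antilinear_abs A"
  have S: "positive_op S" and norm_eq: "\<And>x. norm (S x) = norm (A x)"
    using antilinear_abs_properties[OF assms(2)] by (auto simp: S_def)
  have sym: "\<And>x y. inner (S x) y = inner x (S y)" and linS: "linear S"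
    using S by (auto simp: positive_op_iff positive_semidefinite_def bounded_linear.linear)
  let ?M = "closure (range S)"
  have kernel: "y \<in> op_kernel A \<longleftrightarrow> (\<forall>x. inner y (S x) = 0)" for y
  proof -
    have "y \<in> op_kernel A \<longleftrightarrow> S y = 0"
      using norm_eq[of y] by (auto simp: op_kernel_def)
    also have "\<dots> \<longleftrightarrow> (\<forall>x. inner (S y) x = 0)"
      by (metis inner_eq_zero_iff inner_zero_left)
    finally show ?thesis by (simp add: sym)
  qed
  obtain J where J: "bounded_antilinear J" "\<And>x. J (S x) = A x"
    and J0: "\<And>y. (\<And>x. inner y (S x) = 0) \<Longrightarrow> J y = 0"
    using antilinear_factorization[OF assms(2) S norm_eq] by blast
  have blJ: "bounded_linear J" using J by (simp add: bounded_antilinear_def)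
  have isometric: "norm (J u) = norm u" if "u \<in> ?M" for u
  proof -
    have "closed {u. norm (J u) = norm u}"
      by (intro closed_Collect_eq continuous_intros bounded_linear.continuous_on[OF blJ])
    then have "?M \<subseteq> {u. norm (J u) = norm u}"
      using J norm_eq by (intro closure_minimal) auto
    then show ?thesis using that by auto
  qed
  \<comment> \<open>The orthogonal decomposition of the space into \<open>M\<close> and \<open>ker A\<close>.\<close>
  have split: "\<exists>p\<in>?M. y - p \<in> op_kernel A" for y
    using orthogonal_projection_exists[OF linS, of y] kernel by metis
  have kerJ: "op_kernel J = op_kernel A"
  proof (intro equalityI subsetI)
    fix y assume "y \<in> op_kernel A"
    then show "y \<in> op_kernel J" using J0 kernel by (simp add: op_kernel_def)
  next
    fix y assume y: "y \<in> op_kernel J"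
    obtain p where p: "p \<in> ?M" "y - p \<in> op_kernel A" using split by blast
    then have "J (y - p) = 0" using J0 kernel by simp
    then have "J p = 0"
      using y by (simp add: op_kernel_def linear_diff[OF bounded_linear.linear[OF blJ]])
    then have "p = 0" using isometric[OF p(1)] by simp
    then show "y \<in> op_kernel A" using p by simp
  qed
  show ?thesis
  proof (rule ex1I)
    have "norm (J x) = norm x" if x: "x \<in> corthogonal_comp (op_kernel J)" for x
    proof -
      obtain p where p: "p \<in> ?M" "x - p \<in> op_kernel A" using split by blast
      then have "cinner x (x - p) = 0" using x kerJ by (simp add: corthogonal_comp_def)
      then have "inner x (x - p) = 0" by (metis Re_cinner zero_complex.sel(1))
      moreover have "inner (x - p) p = 0"
      proof (rule orthogonal_to_closure)
        show "inner (x - p) (S v) = 0" for v using p(2) kernel by blast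
      qed (rule p(1))
      ultimately have "inner (x - p) (x - p) = 0"
        by (simp add: inner_diff_left inner_diff_right inner_commute)
      then show ?thesis using p isometric by simp
    qed
    then have "antilinear_partial_isometry J"
      using J by (simp add: antilinear_partial_isometry_def)
    then show "antilinear_partial_isometry J \<and> A = J \<circ> antilinear_abs A \<and> op_kernel J = op_kernel A"
      using J kerJ by (auto simp: S_def)
  next
    fix L assume L: "antilinear_partial_isometry L \<and> A = L \<circ> antilinear_abs A \<and> op_kernel L = op_kernel A"
    then have blL: "bounded_linear L"
      by (simp add: antilinear_partial_isometry_def bounded_antilinear_def)
    have "L (S x) = A x" for x
      using L by (metis S_def comp_apply)
    then have "?M \<subseteq> {u. L u = J u}"
      using J by (intro closure_minimal closed_Collect_eq bounded_linear.continuous_on[OF blL]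
          bounded_linear.continuous_on[OF blJ] continuous_intros) auto
    then have agree: "L u = J u" if "u \<in> ?M" for u using that by auto
    show "L = J"
    proof
      fix y
      obtain p where p: "p \<in> ?M" "y - p \<in> op_kernel A" using split by blast
      then have "y - p \<in> op_kernel L" "y - p \<in> op_kernel J" using L kerJ by auto
      then have "L y = L p" "J y = J p"
        by (simp_all add: op_kernel_def linear_diff[OF bounded_linear.linear[OF blL]]
            linear_diff[OF bounded_linear.linear[OF blJ]])
      then show "L y = J y" using agree[OF p(1)] by simp
    qed
  qed
qed

end
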